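(* (Master Theorem.) Let $\varphi$ be an LTL formula in negation normal form and let $w$ be an infinite word over $2^{Ap}$. Then $w \models \varphi$ if and only if there exist sets $X \subseteq \mu(\varphi)$ and $Y \subseteq \nu(\varphi)$ satisfying all of the following: (1) there exists $i \geq 0$ such that $w_i \models \varphi_i[X]_\nu$, where $\varphi_i := \mathit{af}(\varphi, w_{0i})$; (2) for every $\psi \in X$: $w \models \mathbf{G}\mathbf{F}(\psi[Y]_\mu)$; (3) for every $\psi \in Y$: $w \models \mathbf{F}\mathbf{G}(\psi[X]_\nu)$.
   Context: LTL formulas in negation normal form over a finite set $Ap$ of atomic propositions are given by $\varphi ::= \mathbf{tt} \mid \mathbf{ff} \mid a \mid \neg a \mid \varphi\wedge\varphi \mid \varphi\vee\varphi \mid \mathbf{X}\varphi \mid \mathbf{F}\varphi \mid \mathbf{G}\varphi \mid \varphi\mathbf{U}\varphi \mid \varphi\mathbf{W}\varphi \mid \varphi\mathbf{M}\varphi \mid \varphi\mathbf{R}\varphi$ with $a \in Ap$. For an infinite word $w = w[0]w[1]\cdots$ over $2^{Ap}$, $w_i$ is the suffix $w[i]w[i+1]\cdots$ and $w_{ij}$ is the finite infix $w[i]\cdots w[j-1]$. Semantics: standard for $\mathbf{tt},\mathbf{ff},a,\neg a,\wedge,\vee$; $w\models\mathbf{X}\varphi$ iff $w_1\models\varphi$; $w\models\mathbf{F}\varphi$ iff $\exists k.\,w_k\models\varphi$; $w\models\mathbf{G}\varphi$ iff $\forall k.\,w_k\models\varphi$; $w\models\varphi\mathbf{U}\psi$ iff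 $\exists k.\,w_k\models\psi$ and $\forall j<k.\,w_j\models\varphi$; $w\models\varphi\mathbf{W}\psi$ iff $w\models\mathbf{G}\varphi$ or $w\models\varphi\mathbf{U}\psi$; $w\models\varphi\mathbf{M}\psi$ iff $\exists k.\,w_k\models\varphi$ and $\forall j\le k.\,w_j\models\psi$; $w\models\varphi\mathbf{R}\psi$ iff $w\models\mathbf{G}\psi$ or $w\models\varphi\mathbf{M}\psi$. The function $\mathit{af}$ ("after"): for a letter $\nu\in 2^{Ap}$, $\mathit{af}(a,\nu)=\mathbf{tt}$ if $a\in\nu$ and $\mathbf{ff}$ otherwise; $\mathit{af}(\neg a,\nu)=\mathbf{ff}$ if $a\in\nu$ and $\mathbf{tt}$ otherwise; $\mathit{af}(\mathbf{tt},\nu)=\mathbf{tt}$, $\mathit{af}(\mathbf{ff},\nu)=\mathbf{ff}$; $\mathit{af}$ commutes with $\wedge,\vee$; $\mathit{af}(\mathbf{X}\varphi,\nu)=\varphi$; $\mathit{af}(\mathbf{F}\varphi,\nu)=\mathit{af}(\varphi,\nu)\vee\mathbf{F}\varphi$; $\mathit{af}(\mathbf{G}\varphi,\nu)=\mathit{af}(\varphi,\nu)\wedge\mathbf{G}\varphi$; $\mathit{af}(\varphi\mathbf{U}\psi,\nu)=\mathit{af}(\psi,\nu)\vee(\mathit{af}(\varphi,\nu)\wedge\varphi\mathbf{U}\psi)$; same shape for $\mathbf{W}$; $\mathit{af}(\varphi\mathbf{M}\psi,\nu)=\mathit{af}(\psi,\nu)\wedge(\mathit{af}(\varphi,\nu)\vee\varphi\mathbf{M}\psi)$;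 same shape for $\mathbf{R}$. Extended to finite words by $\mathit{af}(\varphi,\epsilon)=\varphi$, $\mathit{af}(\varphi,\nu u)=\mathit{af}(\mathit{af}(\varphi,\nu),u)$. $\mu(\varphi)$ is the set of subformulas of $\varphi$ of the form $\mathbf{F}\psi$, $\psi_1\mathbf{U}\psi_2$, $\psi_1\mathbf{M}\psi_2$; $\nu(\varphi)$ is the set of subformulas of the form $\mathbf{G}\psi$, $\psi_1\mathbf{W}\psi_2$, $\psi_1\mathbf{R}\psi_2$. For a set $X$ of formulas, $\psi[X]_\nu$ is defined inductively: it is $\psi$ for $\psi\in\{\mathbf{tt},\mathbf{ff},a,\neg a\}$; it commutes with $\mathbf{X},\mathbf{G},\wedge,\vee,\mathbf{W},\mathbf{R}$ (e.g. $(\psi_1\mathbf{W}\psi_2)[X]_\nu=(\psi_1[X]_\nu)\mathbf{W}(\psi_2[X]_\nu)$); $(\mathbf{F}\psi)[X]_\nu=\mathbf{tt}$ if $\mathbf{F}\psi\in X$ and $\mathbf{ff}$ otherwise; $(\psi_1\mathbf{U}\psi_2)[X]_\nu=(\psi_1[X]_\nu)\mathbf{W}(\psi_2[X]_\nu)$ if $\psi_1\mathbf{U}\psi_2\in X$ and $\mathbf{ff}$ otherwise; $(\psi_1\mathbf{M}\psi_2)[X]_\nu=(\psi_1[X]_\nu)\mathbf{R}(\psi_2[X]_\nu)$ if $\psi_1\mathbf{M}\psi_2\in X$ and $\mathbf{ff}$ otherwise. Dually, for a set $Y$ of formulas, $\psi[Y]_\mu$: it is $\psi$ for $\psi\in\{\mathbf{tt},\mathbf{ff},a,\neg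 a\}$; it commutes with $\mathbf{X},\mathbf{F},\wedge,\vee,\mathbf{U},\mathbf{M}$; $(\mathbf{G}\psi)[Y]_\mu=\mathbf{tt}$ if $\mathbf{G}\psi\in Y$ and $\mathbf{ff}$ otherwise; $(\psi_1\mathbf{W}\psi_2)[Y]_\mu=\mathbf{tt}$ if $\psi_1\mathbf{W}\psi_2\in Y$ and $(\psi_1[Y]_\mu)\mathbf{U}(\psi_2[Y]_\mu)$ otherwise; $(\psi_1\mathbf{R}\psi_2)[Y]_\mu=\mathbf{tt}$ if $\psi_1\mathbf{R}\psi_2\in Y$ and $(\psi_1[Y]_\mu)\mathbf{M}(\psi_2[Y]_\mu)$ otherwise. *)

theory Defs
  imports "HOL-Library.Omega_Words_Fun"
begin

datatype (atoms: 'a) ltln =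
    True_ltln                        ("true\<^sub>n")
  | False_ltln                       ("false\<^sub>n")
  | Prop_ltln 'a                     ("prop\<^sub>n'(_')")
  | Nprop_ltln 'a                    ("nprop\<^sub>n'(_')")
  | And_ltln "'a ltln" "'a ltln"     ("_ and\<^sub>n _" [82,82] 81)
  | Or_ltln "'a ltln" "'a ltln"      ("_ or\<^sub>n _" [81,81] 80)
  | Next_ltln "'a ltln"              ("X\<^sub>n _" [88] 87)
  | Finally_ltln "'a ltln"           ("F\<^sub>n _" [88] 87)
  | Globally_ltln "'a ltln"          ("G\<^sub>n _" [88] 87)
  | Until_ltln "'a ltln" "'a ltln"   ("_ U\<^sub>n _" [84,84] 83)
  | WeakUntil_ltln "'a ltln" "'a ltln" ("_ W\<^sub>n _" [84,84] 83)
  | StrongRelease_ltln "'a ltln" "'a ltln" ("_ M\<^sub>n _" [84,84] 83)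
  | Release_ltln "'a ltln" "'a ltln" ("_ R\<^sub>n _" [84,84] 83)

text \<open>In the clauses for \<open>W\<close> and \<open>R\<close>, the two disjuncts are the unfolded semantics of
  \<open>G \<phi>\<close> and \<open>\<phi> U \<psi>\<close>, and of \<open>G \<psi>\<close> and \<open>\<phi> M \<psi>\<close>, respectively.\<close>

primrec semantics_ltln :: "'a set word \<Rightarrow> 'a ltln \<Rightarrow> bool" ("_ \<Turnstile>\<^sub>n _" [80,80] 80) where
  "w \<Turnstile>\<^sub>n true\<^sub>n \<longleftrightarrow> True"
| "w \<Turnstile>\<^sub>n false\<^sub>n \<longleftrightarrow> False"
| "w \<Turnstile>\<^sub>n prop\<^sub>n(a) \<longleftrightarrow> a \<in> w 0"
| "w \<Turnstile>\<^sub>n nprop\<^sub>n(a) \<longleftrightarrow> a \<notin> w 0"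
| "w \<Turnstile>\<^sub>n (\<phi> and\<^sub>n \<psi>) \<longleftrightarrow> w \<Turnstile>\<^sub>n \<phi> \<and> w \<Turnstile>\<^sub>n \<psi>"
| "w \<Turnstile>\<^sub>n (\<phi> or\<^sub>n \<psi>) \<longleftrightarrow> w \<Turnstile>\<^sub>n \<phi> \<or> w \<Turnstile>\<^sub>n \<psi>"
| "w \<Turnstile>\<^sub>n (X\<^sub>n \<phi>) \<longleftrightarrow> suffix 1 w \<Turnstile>\<^sub>n \<phi>"
| "w \<Turnstile>\<^sub>n (F\<^sub>n \<phi>) \<longleftrightarrow> (\<exists>k. suffix k w \<Turnstile>\<^sub>n \<phi>)"
| "w \<Turnstile>\<^sub>n (G\<^sub>n \<phi>) \<longleftrightarrow> (\<forall>k. suffix k w \<Turnstile>\<^sub>n \<phi>)"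
| "w \<Turnstile>\<^sub>n (\<phi> U\<^sub>n \<psi>) \<longleftrightarrow> (\<exists>k. suffix k w \<Turnstile>\<^sub>n \<psi> \<and> (\<forall>j<k. suffix j w \<Turnstile>\<^sub>n \<phi>))"
| "w \<Turnstile>\<^sub>n (\<phi> W\<^sub>n \<psi>) \<longleftrightarrow>
     (\<forall>k. suffix k w \<Turnstile>\<^sub>n \<phi>) \<or> (\<exists>k. suffix k w \<Turnstile>\<^sub>n \<psi> \<and> (\<forall>j<k. suffix j w \<Turnstile>\<^sub>n \<phi>))"
| "w \<Turnstile>\<^sub>n (\<phi> M\<^sub>n \<psi>) \<longleftrightarrow> (\<exists>k. suffix k w \<Turnstile>\<^sub>n \<phi> \<and> (\<forall>j\<le>k. suffix j w \<Turnstile>\<^sub>n \<psi>))"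
| "w \<Turnstile>\<^sub>n (\<phi> R\<^sub>n \<psi>) \<longleftrightarrow>
     (\<forall>k. suffix k w \<Turnstile>\<^sub>n \<psi>) \<or> (\<exists>k. suffix k w \<Turnstile>\<^sub>n \<phi> \<and> (\<forall>j\<le>k. suffix j w \<Turnstile>\<^sub>n \<psi>))"

primrec af_letter :: "'a ltln \<Rightarrow> 'a set \<Rightarrow> 'a ltln" where
  "af_letter true\<^sub>n \<nu> = true\<^sub>n"
| "af_letter false\<^sub>n \<nu> = false\<^sub>n"
| "af_letter prop\<^sub>n(a) \<nu> = (if a \<in> \<nu> then true\<^sub>n else false\<^sub>n)"
| "af_letter nprop\<^sub>n(a) \<nu> = (if a \<in> \<nu> then false\<^sub>n else true\<^sub>n)"
| "af_letter (\<phi> and\<^sub>n \<psi>) \<nu> = af_letter \<phi> \<nu> and\<^sub>n af_letter \<psi> \<nu>"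
| "af_letter (\<phi> or\<^sub>n \<psi>) \<nu> = af_letter \<phi> \<nu> or\<^sub>n af_letter \<psi> \<nu>"
| "af_letter (X\<^sub>n \<phi>) \<nu> = \<phi>"
| "af_letter (F\<^sub>n \<phi>) \<nu> = af_letter \<phi> \<nu> or\<^sub>n (F\<^sub>n \<phi>)"
| "af_letter (G\<^sub>n \<phi>) \<nu> = af_letter \<phi> \<nu> and\<^sub>n (G\<^sub>n \<phi>)"
| "af_letter (\<phi> U\<^sub>n \<psi>) \<nu> = af_letter \<psi> \<nu> or\<^sub>n (af_letter \<phi> \<nu> and\<^sub>n (\<phi> U\<^sub>n \<psi>))"
| "af_letter (\<phi> W\<^sub>n \<psi>) \<nu> = af_letter \<psi> \<nu> or\<^sub>n (af_letter \<phi> \<nu> and\<^sub>n (\<phi> W\<^sub>n \<psi>))"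
| "af_letter (\<phi> M\<^sub>n \<psi>) \<nu> = af_letter \<psi> \<nu> and\<^sub>n (af_letter \<phi> \<nu> or\<^sub>n (\<phi> M\<^sub>n \<psi>))"
| "af_letter (\<phi> R\<^sub>n \<psi>) \<nu> = af_letter \<psi> \<nu> and\<^sub>n (af_letter \<phi> \<nu> or\<^sub>n (\<phi> R\<^sub>n \<psi>))"

primrec af :: "'a ltln \<Rightarrow> 'a set list \<Rightarrow> 'a ltln" where
  "af \<phi> [] = \<phi>"
| "af \<phi> (\<nu> # u) = af (af_letter \<phi> \<nu>) u"

primrec subformulas :: "'a ltln \<Rightarrow> 'a ltln set" where
  "subformulas true\<^sub>n = {true\<^sub>n}"
| "subformulas false\<^sub>n = {false\<^sub>n}"
| "subformulas prop\<^sub>n(a) = {prop\<^sub>n(a)}"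
| "subformulas nprop\<^sub>n(a) = {nprop\<^sub>n(a)}"
| "subformulas (\<phi> and\<^sub>n \<psi>) = {\<phi> and\<^sub>n \<psi>} \<union> subformulas \<phi> \<union> subformulas \<psi>"
| "subformulas (\<phi> or\<^sub>n \<psi>) = {\<phi> or\<^sub>n \<psi>} \<union> subformulas \<phi> \<union> subformulas \<psi>"
| "subformulas (X\<^sub>n \<phi>) = {X\<^sub>n \<phi>} \<union> subformulas \<phi>"
| "subformulas (F\<^sub>n \<phi>) = {F\<^sub>n \<phi>} \<union> subformulas \<phi>"
| "subformulas (G\<^sub>n \<phi>) = {G\<^sub>n \<phi>} \<union> subformulas \<phi>"
| "subformulas (\<phi> U\<^sub>n \<psi>) = {\<phi> U\<^sub>n \<psi>} \<union> subformulas \<phi> \<union> subformulas \<psi>"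
| "subformulas (\<phi> W\<^sub>n \<psi>) = {\<phi> W\<^sub>n \<psi>} \<union> subformulas \<phi> \<union> subformulas \<psi>"
| "subformulas (\<phi> M\<^sub>n \<psi>) = {\<phi> M\<^sub>n \<psi>} \<union> subformulas \<phi> \<union> subformulas \<psi>"
| "subformulas (\<phi> R\<^sub>n \<psi>) = {\<phi> R\<^sub>n \<psi>} \<union> subformulas \<phi> \<union> subformulas \<psi>"

definition subformulas_mu :: "'a ltln \<Rightarrow> 'a ltln set" ("\<mu>") where
  "\<mu> \<phi> = {\<psi> \<in> subformulas \<phi>.
     (\<exists>\<psi>\<^sub>1. \<psi> = F\<^sub>n \<psi>\<^sub>1) \<or> (\<exists>\<psi>\<^sub>1 \<psi>\<^sub>2. \<psi> = \<psi>\<^sub>1 U\<^sub>n \<psi>\<^sub>2) \<or> (\<exists>\<psi>\<^sub>1 \<psi>\<^sub>2. \<psi> = \<psi>\<^sub>1 M\<^sub>n \<psi>\<^sub>2)}"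

definition subformulas_nu :: "'a ltln \<Rightarrow> 'a ltln set" ("\<nu>") where
  "\<nu> \<phi> = {\<psi> \<in> subformulas \<phi>.
     (\<exists>\<psi>\<^sub>1. \<psi> = G\<^sub>n \<psi>\<^sub>1) \<or> (\<exists>\<psi>\<^sub>1 \<psi>\<^sub>2. \<psi> = \<psi>\<^sub>1 W\<^sub>n \<psi>\<^sub>2) \<or> (\<exists>\<psi>\<^sub>1 \<psi>\<^sub>2. \<psi> = \<psi>\<^sub>1 R\<^sub>n \<psi>\<^sub>2)}"

primrec subst_nu :: "'a ltln \<Rightarrow> 'a ltln set \<Rightarrow> 'a ltln" ("_[_]\<^sub>\<nu>" [90,60] 89) where
  "true\<^sub>n[X]\<^sub>\<nu> = true\<^sub>n"
| "false\<^sub>n[X]\<^sub>\<nu> = false\<^sub>n"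
| "prop\<^sub>n(a)[X]\<^sub>\<nu> = prop\<^sub>n(a)"
| "nprop\<^sub>n(a)[X]\<^sub>\<nu> = nprop\<^sub>n(a)"
| "(\<phi> and\<^sub>n \<psi>)[X]\<^sub>\<nu> = (\<phi>[X]\<^sub>\<nu>) and\<^sub>n (\<psi>[X]\<^sub>\<nu>)"
| "(\<phi> or\<^sub>n \<psi>)[X]\<^sub>\<nu> = (\<phi>[X]\<^sub>\<nu>) or\<^sub>n (\<psi>[X]\<^sub>\<nu>)"
| "(X\<^sub>n \<phi>)[X]\<^sub>\<nu> = X\<^sub>n (\<phi>[X]\<^sub>\<nu>)"
| "(F\<^sub>n \<phi>)[X]\<^sub>\<nu> = (if F\<^sub>n \<phi> \<in> X then true\<^sub>n else false\<^sub>n)"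
| "(G\<^sub>n \<phi>)[X]\<^sub>\<nu> = G\<^sub>n (\<phi>[X]\<^sub>\<nu>)"
| "(\<phi> U\<^sub>n \<psi>)[X]\<^sub>\<nu> = (if \<phi> U\<^sub>n \<psi> \<in> X then (\<phi>[X]\<^sub>\<nu>) W\<^sub>n (\<psi>[X]\<^sub>\<nu>) else false\<^sub>n)"
| "(\<phi> W\<^sub>n \<psi>)[X]\<^sub>\<nu> = (\<phi>[X]\<^sub>\<nu>) W\<^sub>n (\<psi>[X]\<^sub>\<nu>)"
| "(\<phi> M\<^sub>n \<psi>)[X]\<^sub>\<nu> = (if \<phi> M\<^sub>n \<psi> \<in> X then (\<phi>[X]\<^sub>\<nu>) R\<^sub>n (\<psi>[X]\<^sub>\<nu>) else false\<^sub>n)"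
| "(\<phi> R\<^sub>n \<psi>)[X]\<^sub>\<nu> = (\<phi>[X]\<^sub>\<nu>) R\<^sub>n (\<psi>[X]\<^sub>\<nu>)"

primrec subst_mu :: "'a ltln \<Rightarrow> 'a ltln set \<Rightarrow> 'a ltln" ("_[_]\<^sub>\<mu>" [90,60] 89) where
  "true\<^sub>n[Y]\<^sub>\<mu> = true\<^sub>n"
| "false\<^sub>n[Y]\<^sub>\<mu> = false\<^sub>n"
| "prop\<^sub>n(a)[Y]\<^sub>\<mu> = prop\<^sub>n(a)"
| "nprop\<^sub>n(a)[Y]\<^sub>\<mu> = nprop\<^sub>n(a)"
| "(\<phi> and\<^sub>n \<psi>)[Y]\<^sub>\<mu> = (\<phi>[Y]\<^sub>\<mu>) and\<^sub>n (\<psi>[Y]\<^sub>\<mu>)"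
| "(\<phi> or\<^sub>n \<psi>)[Y]\<^sub>\<mu> = (\<phi>[Y]\<^sub>\<mu>) or\<^sub>n (\<psi>[Y]\<^sub>\<mu>)"
| "(X\<^sub>n \<phi>)[Y]\<^sub>\<mu> = X\<^sub>n (\<phi>[Y]\<^sub>\<mu>)"
| "(F\<^sub>n \<phi>)[Y]\<^sub>\<mu> = F\<^sub>n (\<phi>[Y]\<^sub>\<mu>)"
| "(G\<^sub>n \<phi>)[Y]\<^sub>\<mu> = (if G\<^sub>n \<phi> \<in> Y then true\<^sub>n else false\<^sub>n)"
| "(\<phi> U\<^sub>n \<psi>)[Y]\<^sub>\<mu> = (\<phi>[Y]\<^sub>\<mu>) U\<^sub>n (\<psi>[Y]\<^sub>\<mu>)"
| "(\<phi> W\<^sub>n \<psi>)[Y]\<^sub>\<mu> = (if \<phi> W\<^sub>n \<psi> \<in> Y then true\<^sub>n else (\<phi>[Y]\<^sub>\<mu>) U\<^sub>n (\<psi>[Y]\<^sub>\<mu>))"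
| "(\<phi> M\<^sub>n \<psi>)[Y]\<^sub>\<mu> = (\<phi>[Y]\<^sub>\<mu>) M\<^sub>n (\<psi>[Y]\<^sub>\<mu>)"
| "(\<phi> R\<^sub>n \<psi>)[Y]\<^sub>\<mu> = (if \<phi> R\<^sub>n \<psi> \<in> Y then true\<^sub>n else (\<phi>[Y]\<^sub>\<mu>) M\<^sub>n (\<psi>[Y]\<^sub>\<mu>))"

end

theory Submission
  imports Defs
begin

text \<open>
  If \<open>w\<close> satisfies \<open>\<phi>\<close>, take \<open>X\<close> to be the \<open>\<mu>\<close>-subformulas that hold infinitely often and \<open>Y\<close> the
  \<open>\<nu>\<close>-subformulas that hold almost always. Only finitely many subformulas exist, so from some suffix
  on, a \<open>\<mu>\<close>-subformula that still holds somewhere lies in \<open>X\<close>; there the substitution by \<open>X\<close>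
  preserves truth. Conversely, conditions (2) and (3) force the formulas of \<open>X\<close> to hold infinitely
  often and those of \<open>Y\<close> to hold almost always, by a simultaneous induction on formula size: a member
  of \<open>X\<close> is itself no \<open>\<nu>\<close>-formula, so its substitution by \<open>Y\<close> only looks up strictly smaller members
  of \<open>Y\<close>, and vice versa. Substitution by such an \<open>X\<close> reflects truth, and \<open>af\<close> is semantically exact.
\<close>

section \<open>Monotonicity, weak against strong operators, and limit behaviour along
  suffixes\<close>

section \<open>Semantics of the temporal operators\<close>

text \<open>The witnessing position stays the same. The premises range only over suffixes of
  \<open>w\<close>, the form in which the inductions on substituted formulas supply them.\<close>

lemma Until_mono:
  assumes "w \<Turnstile>\<^sub>n (\<phi> U\<^sub>n \<psi>)"
    and "\<And>k. suffix k w \<Turnstile>\<^sub>n \<phi> \<Longrightarrow> suffix k w \<Turnstile>\<^sub>n \<phi>'"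
    and "\<And>k. suffix k w \<Turnstile>\<^sub>n \<psi> \<Longrightarrow> suffix k w \<Turnstile>\<^sub>n \<psi>'"
  shows "w \<Turnstile>\<^sub>n (\<phi>' U\<^sub>n \<psi>')"
  using assms unfolding semantics_ltln.simps by blast

lemma WeakUntil_mono:
  assumes "w \<Turnstile>\<^sub>n (\<phi> W\<^sub>n \<psi>)"
    and "\<And>k. suffix k w \<Turnstile>\<^sub>n \<phi> \<Longrightarrow> suffix k w \<Turnstile>\<^sub>n \<phi>'"
    and "\<And>k. suffix k w \<Turnstile>\<^sub>n \<psi> \<Longrightarrow> suffix k w \<Turnstile>\<^sub>n \<psi>'"
  shows "w \<Turnstile>\<^sub>n (\<phi>' W\<^sub>n \<psi>')"
  using assms unfolding semantics_ltln.simps by blast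

lemma StrongRelease_mono:
  assumes "w \<Turnstile>\<^sub>n (\<phi> M\<^sub>n \<psi>)"
    and "\<And>k. suffix k w \<Turnstile>\<^sub>n \<phi> \<Longrightarrow> suffix k w \<Turnstile>\<^sub>n \<phi>'"
    and "\<And>k. suffix k w \<Turnstile>\<^sub>n \<psi> \<Longrightarrow> suffix k w \<Turnstile>\<^sub>n \<psi>'"
  shows "w \<Turnstile>\<^sub>n (\<phi>' M\<^sub>n \<psi>')"
  using assms unfolding semantics_ltln.simps by blast

lemma Release_mono:
  assumes "w \<Turnstile>\<^sub>n (\<phi> R\<^sub>n \<psi>)"
    and "\<And>k. suffix k w \<Turnstile>\<^sub>n \<phi> \<Longrightarrow> suffix k w \<Turnstile>\<^sub>n \<phi>'"
    and "\<And>k. suffix k w \<Turnstile>\<^sub>n \<psi> \<Longrightarrow> suffix k w \<Turnstile>\<^sub>n \<psi>'"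
  shows "w \<Turnstile>\<^sub>n (\<phi>' R\<^sub>n \<psi>')"
  using assms unfolding semantics_ltln.simps by blast

lemma Until_imp_WeakUntil: "w \<Turnstile>\<^sub>n (\<phi> U\<^sub>n \<psi>) \<Longrightarrow> w \<Turnstile>\<^sub>n (\<phi> W\<^sub>n \<psi>)"
  by simp

lemma StrongRelease_imp_Release: "w \<Turnstile>\<^sub>n (\<phi> M\<^sub>n \<psi>) \<Longrightarrow> w \<Turnstile>\<^sub>n (\<phi> R\<^sub>n \<psi>)"
  by simp

text \<open>If \<open>\<phi>\<close> holds forever, any occurrence of \<open>\<psi>\<close> is
  already an until-witness. This recovers the strong operator after substitution has weakened U to
  W.\<close>

lemma WeakUntil_F_imp_Until:
  "w \<Turnstile>\<^sub>n (\<phi> W\<^sub>n \<psi>) \<Longrightarrow> w \<Turnstile>\<^sub>n (F\<^sub>n \<psi>) \<Longrightarrow> w \<Turnstile>\<^sub>n (\<phi> U\<^sub>n \<psi>)"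
  unfolding semantics_ltln.simps by blast

lemma Release_F_imp_StrongRelease:
  "w \<Turnstile>\<^sub>n (\<phi> R\<^sub>n \<psi>) \<Longrightarrow> w \<Turnstile>\<^sub>n (F\<^sub>n \<phi>) \<Longrightarrow> w \<Turnstile>\<^sub>n (\<phi> M\<^sub>n \<psi>)"
  unfolding semantics_ltln.simps by blast

text \<open>A position beyond \<open>m\<close> is \<open>m\<close> plus an offset, so nested
  suffixes express "infinitely often". In filter form, finitely many almost-always facts can be
  intersected and combined with an infinitely-often fact.\<close>

lemma semantics_GF_iff:
  "w \<Turnstile>\<^sub>n (G\<^sub>n (F\<^sub>n \<phi>)) \<longleftrightarrow> (\<exists>\<^sub>F k in sequentially. suffix k w \<Turnstile>\<^sub>n \<phi>)"
  by (auto simp: frequently_sequentially) (metis le_add1, metis le_Suc_ex)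

lemma semantics_FG_iff:
  "w \<Turnstile>\<^sub>n (F\<^sub>n (G\<^sub>n \<phi>)) \<longleftrightarrow> (\<forall>\<^sub>F k in sequentially. suffix k w \<Turnstile>\<^sub>n \<phi>)"
  by (auto simp: eventually_sequentially) (metis le_Suc_ex, metis le_add1)

text \<open>Limit behaviour ignores finite prefixes. Hypotheses of this form therefore pass to every
  suffix when an induction moves along the word.\<close>

lemma GF_suffix: "suffix k w \<Turnstile>\<^sub>n (G\<^sub>n (F\<^sub>n \<phi>)) \<longleftrightarrow> w \<Turnstile>\<^sub>n (G\<^sub>n (F\<^sub>n \<phi>))"
  unfolding semantics_GF_iff frequently_def
  using eventually_sequentially_seg[of "\<lambda>i. \<not> suffix i w \<Turnstile>\<^sub>n \<phi>" k]
  by (simp add: add.commute)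

lemma FG_suffix: "suffix k w \<Turnstile>\<^sub>n (F\<^sub>n (G\<^sub>n \<phi>)) \<longleftrightarrow> w \<Turnstile>\<^sub>n (F\<^sub>n (G\<^sub>n \<phi>))"
  unfolding semantics_FG_iff
  using eventually_sequentially_seg[of "\<lambda>i. suffix i w \<Turnstile>\<^sub>n \<phi>" k]
  by (simp add: add.commute)

lemma F_suffix: "suffix k w \<Turnstile>\<^sub>n (F\<^sub>n \<phi>) \<Longrightarrow> w \<Turnstile>\<^sub>n (F\<^sub>n \<phi>)"
  by auto

lemma G_suffix: "w \<Turnstile>\<^sub>n (G\<^sub>n \<phi>) \<Longrightarrow> suffix k w \<Turnstile>\<^sub>n (G\<^sub>n \<phi>)"
  by auto

lemma F_of_semantics: "w \<Turnstile>\<^sub>n \<phi> \<Longrightarrow> w \<Turnstile>\<^sub>n (F\<^sub>n \<phi>)"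
  by (auto intro: exI[of _ 0])

lemma semantics_of_G: "w \<Turnstile>\<^sub>n (G\<^sub>n \<phi>) \<Longrightarrow> w \<Turnstile>\<^sub>n \<phi>"
  by (auto dest: spec[of _ 0])

section \<open>The finite sets of least and greatest fixpoint subformulas, and their size
  order\<close>

section \<open>Subformulas\<close>

lemma finite_subformulas: "finite (subformulas \<phi>)"
  by (induction \<phi>) auto

lemma subformulas_trans: "\<psi> \<in> subformulas \<phi> \<Longrightarrow> subformulas \<psi> \<subseteq> subformulas \<phi>"
  by (induction \<phi>) auto

text \<open>Supplies the decreasing measure for the joint induction over \<open>X\<close> and
  \<open>Y\<close>.\<close>

lemma subformulas_size: "\<psi> \<in> subformulas \<phi> \<Longrightarrow> \<psi> = \<phi> \<or> size \<psi> < size \<phi>"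
  by (induction \<phi>) auto

lemma finite_subformulas_mu: "finite (\<mu> \<phi>)"
  unfolding subformulas_mu_def using finite_subformulas by (rule finite_subset[rotated]) blast

lemma finite_subformulas_nu: "finite (\<nu> \<phi>)"
  unfolding subformulas_nu_def using finite_subformulas by (rule finite_subset[rotated]) blast

lemma subformulas_mu_simps:
  "\<mu> true\<^sub>n = {}" "\<mu> false\<^sub>n = {}" "\<mu> prop\<^sub>n(a) = {}" "\<mu> nprop\<^sub>n(a) = {}"
  "\<mu> (\<phi> and\<^sub>n \<psi>) = \<mu> \<phi> \<union> \<mu> \<psi>" "\<mu> (\<phi> or\<^sub>n \<psi>) = \<mu> \<phi> \<union> \<mu> \<psi>" "\<mu> (X\<^sub>n \<phi>) = \<mu> \<phi>"
  "\<mu> (F\<^sub>n \<phi>) = insert (F\<^sub>n \<phi>) (\<mu> \<phi>)" "\<mu> (G\<^sub>n \<phi>) = \<mu> \<phi>"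
  "\<mu> (\<phi> U\<^sub>n \<psi>) = insert (\<phi> U\<^sub>n \<psi>) (\<mu> \<phi> \<union> \<mu> \<psi>)" "\<mu> (\<phi> W\<^sub>n \<psi>) = \<mu> \<phi> \<union> \<mu> \<psi>"
  "\<mu> (\<phi> M\<^sub>n \<psi>) = insert (\<phi> M\<^sub>n \<psi>) (\<mu> \<phi> \<union> \<mu> \<psi>)" "\<mu> (\<phi> R\<^sub>n \<psi>) = \<mu> \<phi> \<union> \<mu> \<psi>"
  unfolding subformulas_mu_def by auto

lemma subformulas_nu_simps:
  "\<nu> true\<^sub>n = {}" "\<nu> false\<^sub>n = {}" "\<nu> prop\<^sub>n(a) = {}" "\<nu> nprop\<^sub>n(a) = {}"
  "\<nu> (\<phi> and\<^sub>n \<psi>) = \<nu> \<phi> \<union> \<nu> \<psi>" "\<nu> (\<phi> or\<^sub>n \<psi>) = \<nu> \<phi> \<union> \<nu> \<psi>" "\<nu> (X\<^sub>n \<phi>) = \<nu> \<phi>"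
  "\<nu> (F\<^sub>n \<phi>) = \<nu> \<phi>" "\<nu> (G\<^sub>n \<phi>) = insert (G\<^sub>n \<phi>) (\<nu> \<phi>)"
  "\<nu> (\<phi> U\<^sub>n \<psi>) = \<nu> \<phi> \<union> \<nu> \<psi>" "\<nu> (\<phi> W\<^sub>n \<psi>) = insert (\<phi> W\<^sub>n \<psi>) (\<nu> \<phi> \<union> \<nu> \<psi>)"
  "\<nu> (\<phi> M\<^sub>n \<psi>) = \<nu> \<phi> \<union> \<nu> \<psi>" "\<nu> (\<phi> R\<^sub>n \<psi>) = insert (\<phi> R\<^sub>n \<psi>) (\<nu> \<phi> \<union> \<nu> \<psi>)"
  unfolding subformulas_nu_def by auto

lemma subformulas_mu_subset: "\<psi> \<in> subformulas \<phi> \<Longrightarrow> \<mu> \<psi> \<subseteq> \<mu> \<phi>"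
  using subformulas_trans unfolding subformulas_mu_def by blast

lemma subformulas_nu_subset: "\<psi> \<in> subformulas \<phi> \<Longrightarrow> \<nu> \<psi> \<subseteq> \<nu> \<phi>"
  using subformulas_trans unfolding subformulas_nu_def by blast

text \<open>The outermost operators differ, whatever the two ambient formulas. Hence a member of
  \<open>X\<close> is never looked up in \<open>Y\<close>, nor a member of \<open>Y\<close> in
  \<open>X\<close>.\<close>

lemma subformulas_mu_nu_disjoint: "\<mu> \<phi> \<inter> \<nu> \<psi> = {}"
  unfolding subformulas_mu_def subformulas_nu_def by auto

text \<open>Unfolding reuses subformulas of \<open>\<phi>\<close> and adds only Boolean connectives
  and constants. Conditions imposed on \<open>\<mu> \<phi>\<close> thus also cover every formula
  reached by \<open>af\<close>.\<close>

lemma subformulas_mu_af_letter: "\<mu> (af_letter \<phi> a) \<subseteq> \<mu> \<phi>"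
  by (induction \<phi>) (auto simp: subformulas_mu_simps)

lemma subformulas_mu_af: "\<mu> (af \<phi> u) \<subseteq> \<mu> \<phi>"
proof (induction u arbitrary: \<phi>)
  case (Cons a u)
  have "\<mu> (af (af_letter \<phi> a) u) \<subseteq> \<mu> (af_letter \<phi> a)"
    by (rule Cons.IH)
  also have "\<dots> \<subseteq> \<mu> \<phi>"
    by (rule subformulas_mu_af_letter)
  finally show ?case
    by simp
qed simp

section \<open>Expansion laws and exactness of \<open>af\<close> along a prefix\<close>

section \<open>Correctness of the after-function\<close>

lemma ex_nat_Suc: "(\<exists>k. P k) \<longleftrightarrow> P 0 \<or> (\<exists>k. P (Suc k))"
  by (metis not0_implies_Suc)

lemma all_nat_Suc: "(\<forall>k. P k) \<longleftrightarrow> P 0 \<and> (\<forall>k. P (Suc k))"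
  by (metis not0_implies_Suc)

lemma F_expansion: "w \<Turnstile>\<^sub>n (F\<^sub>n \<phi>) \<longleftrightarrow> w \<Turnstile>\<^sub>n \<phi> \<or> suffix 1 w \<Turnstile>\<^sub>n (F\<^sub>n \<phi>)"
  using ex_nat_Suc[of "\<lambda>k. suffix k w \<Turnstile>\<^sub>n \<phi>"] by simp

lemma G_expansion: "w \<Turnstile>\<^sub>n (G\<^sub>n \<phi>) \<longleftrightarrow> w \<Turnstile>\<^sub>n \<phi> \<and> suffix 1 w \<Turnstile>\<^sub>n (G\<^sub>n \<phi>)"
  using all_nat_Suc[of "\<lambda>k. suffix k w \<Turnstile>\<^sub>n \<phi>"] by simp

lemma U_expansion:
  "w \<Turnstile>\<^sub>n (\<phi> U\<^sub>n \<psi>) \<longleftrightarrow> w \<Turnstile>\<^sub>n \<psi> \<or> w \<Turnstile>\<^sub>n \<phi> \<and> suffix 1 w \<Turnstile>\<^sub>n (\<phi> U\<^sub>n \<psi>)"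
  using ex_nat_Suc[of "\<lambda>k. suffix k w \<Turnstile>\<^sub>n \<psi> \<and> (\<forall>j<k. suffix j w \<Turnstile>\<^sub>n \<phi>)"]
  by (auto simp: All_less_Suc2)

lemma W_expansion:
  "w \<Turnstile>\<^sub>n (\<phi> W\<^sub>n \<psi>) \<longleftrightarrow> w \<Turnstile>\<^sub>n \<psi> \<or> w \<Turnstile>\<^sub>n \<phi> \<and> suffix 1 w \<Turnstile>\<^sub>n (\<phi> W\<^sub>n \<psi>)"
  using U_expansion[of w \<phi> \<psi>] G_expansion[of w \<phi>] by auto

lemma M_expansion:
  "w \<Turnstile>\<^sub>n (\<phi> M\<^sub>n \<psi>) \<longleftrightarrow> w \<Turnstile>\<^sub>n \<psi> \<and> (w \<Turnstile>\<^sub>n \<phi> \<or> suffix 1 w \<Turnstile>\<^sub>n (\<phi> M\<^sub>n \<psi>))"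
  \<comment> \<open>The bound is written \<open>j<Suc k\<close> rather than \<open>j\<le>k\<close>
    so that \<open>All_less_Suc2\<close> can split off position 0.\<close>
  using ex_nat_Suc[of "\<lambda>k. suffix k w \<Turnstile>\<^sub>n \<phi> \<and> (\<forall>j<Suc k. suffix j w \<Turnstile>\<^sub>n \<psi>)"]
  by (auto simp: All_less_Suc2 simp flip: less_Suc_eq_le)

lemma R_expansion:
  "w \<Turnstile>\<^sub>n (\<phi> R\<^sub>n \<psi>) \<longleftrightarrow> w \<Turnstile>\<^sub>n \<psi> \<and> (w \<Turnstile>\<^sub>n \<phi> \<or> suffix 1 w \<Turnstile>\<^sub>n (\<phi> R\<^sub>n \<psi>))"
  using M_expansion[of w \<phi> \<psi>] G_expansion[of w \<psi>] by auto

text \<open>Each temporal clause of \<open>af_letter\<close> is the matching expansion law with the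
  part about the current letter already evaluated.\<close>

lemma semantics_af_letter: "suffix 1 w \<Turnstile>\<^sub>n af_letter \<phi> (w 0) \<longleftrightarrow> w \<Turnstile>\<^sub>n \<phi>"
proof (induction \<phi>)
  case (Next_ltln \<phi>)
  then show ?case by (simp only: af_letter.simps semantics_ltln.simps(7))
next
  case (Finally_ltln \<phi>)
  \<comment> \<open>The expansion law repeats its left side, so it is applied once by
    \<open>subst\<close>. Only conjunction and disjunction are then opened, which keeps the temporal
    formula folded.\<close>
  then show ?case by (subst F_expansion) (simp only: af_letter.simps semantics_ltln.simps(5,6))
next
  case (Globally_ltln \<phi>)
  then show ?case by (subst G_expansion) (simp only: af_letter.simps semantics_ltln.simps(5,6))
next
  case (Until_ltln \<phi> \<psi>)
  then show ?case by (subst U_expansion) (simp only: af_letter.simps semantics_ltln.simps(5,6))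
next
  case (WeakUntil_ltln \<phi> \<psi>)
  then show ?case by (subst W_expansion) (simp only: af_letter.simps semantics_ltln.simps(5,6))
next
  case (StrongRelease_ltln \<phi> \<psi>)
  then show ?case by (subst M_expansion) (simp only: af_letter.simps semantics_ltln.simps(5,6))
next
  case (Release_ltln \<phi> \<psi>)
  then show ?case by (subst R_expansion) (simp only: af_letter.simps semantics_ltln.simps(5,6))
qed auto

lemma semantics_af: "suffix i w \<Turnstile>\<^sub>n af \<phi> (w [0 \<rightarrow> i]) \<longleftrightarrow> w \<Turnstile>\<^sub>n \<phi>"
proof (induction i arbitrary: \<phi> w)
  case (Suc i)
  \<comment> \<open>\<open>af\<close> consumes its list from the left, so the prefix is split at its
    first letter and the induction continues on \<open>suffix 1 w\<close>; this is why
    \<open>w\<close> is generalised.\<close>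
  have "(w [0 \<rightarrow> Suc i]) = w 0 # ((suffix 1 w) [0 \<rightarrow> i])"
    by (rule nth_equalityI) (auto simp: subsequence_def nth_Cons split: nat.split simp del: upt_Suc)
  then have "suffix (Suc i) w \<Turnstile>\<^sub>n af \<phi> (w [0 \<rightarrow> Suc i])
      \<longleftrightarrow> suffix i (suffix 1 w) \<Turnstile>\<^sub>n af (af_letter \<phi> (w 0)) ((suffix 1 w) [0 \<rightarrow> i])"
    by simp
  also have "\<dots> \<longleftrightarrow> w \<Turnstile>\<^sub>n \<phi>"
    using Suc.IH semantics_af_letter by blast
  finally show ?case .
qed simp

section \<open>When the two substitutions preserve and when they reflect truth\<close>

section \<open>Truth under substitution\<close>

text \<open>A least fixpoint subformula that matters for the truth of \<open>\<phi>\<close> holds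
  somewhere on \<open>w\<close>, so its lookup in \<open>X\<close> succeeds; replacing U by W or M
  by R only weakens. The hypothesis passes to suffixes because an occurrence in a suffix is an
  occurrence in \<open>w\<close>.\<close>

lemma subst_nu_complete:
  assumes "\<forall>\<chi>\<in>\<mu> \<phi>. w \<Turnstile>\<^sub>n (F\<^sub>n \<chi>) \<longrightarrow> \<chi> \<in> X" and "w \<Turnstile>\<^sub>n \<phi>"
  shows "w \<Turnstile>\<^sub>n (\<phi>[X]\<^sub>\<nu>)"
  using assms
proof (induction \<phi> arbitrary: w)
  case (Next_ltln \<phi>)
  have "\<forall>\<chi>\<in>\<mu> \<phi>. suffix 1 w \<Turnstile>\<^sub>n (F\<^sub>n \<chi>) \<longrightarrow> \<chi> \<in> X"
    using Next_ltln.prems(1) F_suffix unfolding subformulas_mu_simps by blast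
  then show ?case
    using Next_ltln.IH Next_ltln.prems(2)
    unfolding semantics_ltln.simps(7) subst_nu.simps(7) by blast
next
  case (Finally_ltln \<phi>)
  then show ?case
    using F_of_semantics[of w "F\<^sub>n \<phi>"]
    by (simp add: subformulas_mu_simps del: semantics_ltln.simps(8))
next
  case (Globally_ltln \<phi>)
  have "suffix k w \<Turnstile>\<^sub>n (\<phi>[X]\<^sub>\<nu>)" for k
    using Globally_ltln.IH[of "suffix k w"] Globally_ltln.prems F_suffix[of k w]
    unfolding subformulas_mu_simps semantics_ltln.simps(9) by blast
  then show ?case by simp
next
  case (Until_ltln \<phi> \<psi>)
  have "suffix k w \<Turnstile>\<^sub>n \<phi> \<Longrightarrow> suffix k w \<Turnstile>\<^sub>n (\<phi>[X]\<^sub>\<nu>)"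
    and "suffix k w \<Turnstile>\<^sub>n \<psi> \<Longrightarrow> suffix k w \<Turnstile>\<^sub>n (\<psi>[X]\<^sub>\<nu>)" for k
    using Until_ltln.IH Until_ltln.prems(1) F_suffix[of k w] unfolding subformulas_mu_simps by blast+
  moreover have "\<phi> U\<^sub>n \<psi> \<in> X"
    using Until_ltln.prems F_of_semantics unfolding subformulas_mu_simps by blast
  ultimately show ?case
    using Until_ltln.prems(2)
    by (simp del: semantics_ltln.simps) (blast intro: Until_mono Until_imp_WeakUntil)
next
  case (WeakUntil_ltln \<phi> \<psi>)
  have "suffix k w \<Turnstile>\<^sub>n \<phi> \<Longrightarrow> suffix k w \<Turnstile>\<^sub>n (\<phi>[X]\<^sub>\<nu>)"
    and "suffix k w \<Turnstile>\<^sub>n \<psi> \<Longrightarrow> suffix k w \<Turnstile>\<^sub>n (\<psi>[X]\<^sub>\<nu>)" for k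
    using WeakUntil_ltln.IH WeakUntil_ltln.prems(1) F_suffix[of k w]
    unfolding subformulas_mu_simps by blast+
  then show ?case
    using WeakUntil_ltln.prems(2)
    by (simp del: semantics_ltln.simps) (blast intro: WeakUntil_mono)
next
  case (StrongRelease_ltln \<phi> \<psi>)
  have "suffix k w \<Turnstile>\<^sub>n \<phi> \<Longrightarrow> suffix k w \<Turnstile>\<^sub>n (\<phi>[X]\<^sub>\<nu>)"
    and "suffix k w \<Turnstile>\<^sub>n \<psi> \<Longrightarrow> suffix k w \<Turnstile>\<^sub>n (\<psi>[X]\<^sub>\<nu>)" for k
    using StrongRelease_ltln.IH StrongRelease_ltln.prems(1) F_suffix[of k w]
    unfolding subformulas_mu_simps by blast+
  moreover have "\<phi> M\<^sub>n \<psi> \<in> X"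
    using StrongRelease_ltln.prems F_of_semantics unfolding subformulas_mu_simps by blast
  ultimately show ?case
    using StrongRelease_ltln.prems(2)
    by (simp del: semantics_ltln.simps) (blast intro: StrongRelease_mono StrongRelease_imp_Release)
next
  case (Release_ltln \<phi> \<psi>)
  have "suffix k w \<Turnstile>\<^sub>n \<phi> \<Longrightarrow> suffix k w \<Turnstile>\<^sub>n (\<phi>[X]\<^sub>\<nu>)"
    and "suffix k w \<Turnstile>\<^sub>n \<psi> \<Longrightarrow> suffix k w \<Turnstile>\<^sub>n (\<psi>[X]\<^sub>\<nu>)" for k
    using Release_ltln.IH Release_ltln.prems(1) F_suffix[of k w]
    unfolding subformulas_mu_simps by blast+
  then show ?case
    using Release_ltln.prems(2)
    by (simp del: semantics_ltln.simps) (blast intro: Release_mono)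
qed (auto simp: subformulas_mu_simps)

text \<open>Substitution forgets the eventuality inside U and M. Membership in \<open>X\<close>
  restores it, since the formula recurs. Recurrence is unaffected by taking suffixes, so the
  hypothesis is available throughout the induction.\<close>

lemma subst_nu_sound:
  assumes "\<forall>\<chi>\<in>\<mu> \<phi> \<inter> X. w \<Turnstile>\<^sub>n (G\<^sub>n (F\<^sub>n \<chi>))" and "w \<Turnstile>\<^sub>n (\<phi>[X]\<^sub>\<nu>)"
  shows "w \<Turnstile>\<^sub>n \<phi>"
  using assms
proof (induction \<phi> arbitrary: w)
  case (Next_ltln \<phi>)
  have "\<forall>\<chi>\<in>\<mu> \<phi> \<inter> X. suffix 1 w \<Turnstile>\<^sub>n (G\<^sub>n (F\<^sub>n \<chi>))"
    using Next_ltln.prems(1) unfolding GF_suffix subformulas_mu_simps by blast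
  then show ?case
    using Next_ltln.IH Next_ltln.prems(2)
    unfolding semantics_ltln.simps(7) subst_nu.simps(7) by blast
next
  case (Finally_ltln \<phi>)
  then have "w \<Turnstile>\<^sub>n (G\<^sub>n (F\<^sub>n (F\<^sub>n \<phi>)))"
    by (auto simp: subformulas_mu_simps split: if_splits)
  then show ?case
    by auto
next
  case (Globally_ltln \<phi>)
  have "suffix k w \<Turnstile>\<^sub>n (\<phi>[X]\<^sub>\<nu>) \<Longrightarrow> suffix k w \<Turnstile>\<^sub>n \<phi>" for k
    using Globally_ltln.IH[of "suffix k w"] Globally_ltln.prems(1)
    unfolding GF_suffix subformulas_mu_simps by blast
  then show ?case
    using Globally_ltln.prems(2) by simp
next
  case (Until_ltln \<phi> \<psi>)
  have "suffix k w \<Turnstile>\<^sub>n (\<phi>[X]\<^sub>\<nu>) \<Longrightarrow> suffix k w \<Turnstile>\<^sub>n \<phi>"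
    and "suffix k w \<Turnstile>\<^sub>n (\<psi>[X]\<^sub>\<nu>) \<Longrightarrow> suffix k w \<Turnstile>\<^sub>n \<psi>" for k
    using Until_ltln.IH[of "suffix k w"] Until_ltln.prems(1)
    unfolding GF_suffix subformulas_mu_simps by blast+
  moreover have "\<phi> U\<^sub>n \<psi> \<in> X" and "w \<Turnstile>\<^sub>n (\<phi>[X]\<^sub>\<nu> W\<^sub>n \<psi>[X]\<^sub>\<nu>)"
    using Until_ltln.prems(2) by (auto split: if_splits)
  ultimately have "w \<Turnstile>\<^sub>n (\<phi> W\<^sub>n \<psi>)"
    by (blast intro: WeakUntil_mono)
  \<comment> \<open>Some later suffix satisfies the until-formula, hence \<open>\<psi>\<close>
    occurs; this is exactly what the weak until leaves open.\<close>
  moreover have "w \<Turnstile>\<^sub>n (G\<^sub>n (F\<^sub>n (\<phi> U\<^sub>n \<psi>)))"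
    using Until_ltln.prems(1) \<open>\<phi> U\<^sub>n \<psi> \<in> X\<close> unfolding subformulas_mu_simps by blast
  then have "w \<Turnstile>\<^sub>n (F\<^sub>n \<psi>)"
    by auto
  ultimately show ?case
    by (rule WeakUntil_F_imp_Until)
next
  case (WeakUntil_ltln \<phi> \<psi>)
  have "suffix k w \<Turnstile>\<^sub>n (\<phi>[X]\<^sub>\<nu>) \<Longrightarrow> suffix k w \<Turnstile>\<^sub>n \<phi>"
    and "suffix k w \<Turnstile>\<^sub>n (\<psi>[X]\<^sub>\<nu>) \<Longrightarrow> suffix k w \<Turnstile>\<^sub>n \<psi>" for k
    using WeakUntil_ltln.IH[of "suffix k w"] WeakUntil_ltln.prems(1)
    unfolding GF_suffix subformulas_mu_simps by blast+
  then show ?case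
    using WeakUntil_ltln.prems(2)
    by (simp del: semantics_ltln.simps) (blast intro: WeakUntil_mono)
next
  case (StrongRelease_ltln \<phi> \<psi>)
  have "suffix k w \<Turnstile>\<^sub>n (\<phi>[X]\<^sub>\<nu>) \<Longrightarrow> suffix k w \<Turnstile>\<^sub>n \<phi>"
    and "suffix k w \<Turnstile>\<^sub>n (\<psi>[X]\<^sub>\<nu>) \<Longrightarrow> suffix k w \<Turnstile>\<^sub>n \<psi>" for k
    using StrongRelease_ltln.IH[of "suffix k w"] StrongRelease_ltln.prems(1)
    unfolding GF_suffix subformulas_mu_simps by blast+
  moreover have "\<phi> M\<^sub>n \<psi> \<in> X" and "w \<Turnstile>\<^sub>n (\<phi>[X]\<^sub>\<nu> R\<^sub>n \<psi>[X]\<^sub>\<nu>)"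
    using StrongRelease_ltln.prems(2) by (auto split: if_splits)
  ultimately have "w \<Turnstile>\<^sub>n (\<phi> R\<^sub>n \<psi>)"
    by (blast intro: Release_mono)
  moreover have "w \<Turnstile>\<^sub>n (G\<^sub>n (F\<^sub>n (\<phi> M\<^sub>n \<psi>)))"
    using StrongRelease_ltln.prems(1) \<open>\<phi> M\<^sub>n \<psi> \<in> X\<close> unfolding subformulas_mu_simps by blast
  then have "w \<Turnstile>\<^sub>n (F\<^sub>n \<phi>)"
    by auto
  ultimately show ?case
    by (rule Release_F_imp_StrongRelease)
next
  case (Release_ltln \<phi> \<psi>)
  have "suffix k w \<Turnstile>\<^sub>n (\<phi>[X]\<^sub>\<nu>) \<Longrightarrow> suffix k w \<Turnstile>\<^sub>n \<phi>"
    and "suffix k w \<Turnstile>\<^sub>n (\<psi>[X]\<^sub>\<nu>) \<Longrightarrow> suffix k w \<Turnstile>\<^sub>n \<psi>" for k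
    using Release_ltln.IH[of "suffix k w"] Release_ltln.prems(1)
    unfolding GF_suffix subformulas_mu_simps by blast+
  then show ?case
    using Release_ltln.prems(2)
    by (simp del: semantics_ltln.simps) (blast intro: Release_mono)
qed (auto simp: subformulas_mu_simps)

text \<open>A true G-formula, or a W- or R-formula true through its "forever" disjunct, stays true
  on all suffixes and therefore lies in \<open>Y\<close>. Otherwise W and R hold as U and M, which
  is what substitution leaves outside \<open>Y\<close>.\<close>

lemma subst_mu_complete:
  assumes "\<forall>\<chi>\<in>\<nu> \<phi>. w \<Turnstile>\<^sub>n (F\<^sub>n (G\<^sub>n \<chi>)) \<longrightarrow> \<chi> \<in> Y" and "w \<Turnstile>\<^sub>n \<phi>"
  shows "w \<Turnstile>\<^sub>n (\<phi>[Y]\<^sub>\<mu>)"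
  using assms
proof (induction \<phi> arbitrary: w)
  case (Next_ltln \<phi>)
  have "\<forall>\<chi>\<in>\<nu> \<phi>. suffix 1 w \<Turnstile>\<^sub>n (F\<^sub>n (G\<^sub>n \<chi>)) \<longrightarrow> \<chi> \<in> Y"
    using Next_ltln.prems(1) unfolding FG_suffix subformulas_nu_simps by blast
  then show ?case
    using Next_ltln.IH Next_ltln.prems(2)
    unfolding semantics_ltln.simps(7) subst_mu.simps(7) by blast
next
  case (Finally_ltln \<phi>)
  have "suffix k w \<Turnstile>\<^sub>n \<phi> \<Longrightarrow> suffix k w \<Turnstile>\<^sub>n (\<phi>[Y]\<^sub>\<mu>)" for k
    using Finally_ltln.IH[of "suffix k w"] Finally_ltln.prems(1)
    unfolding FG_suffix subformulas_nu_simps by blast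
  then show ?case
    using Finally_ltln.prems(2) by auto
next
  case (Globally_ltln \<phi>)
  have "w \<Turnstile>\<^sub>n (F\<^sub>n (G\<^sub>n (G\<^sub>n \<phi>)))"
    using Globally_ltln.prems(2) by auto
  then show ?case
    using Globally_ltln.prems(1) by (simp add: subformulas_nu_simps)
next
  case (Until_ltln \<phi> \<psi>)
  have "suffix k w \<Turnstile>\<^sub>n \<phi> \<Longrightarrow> suffix k w \<Turnstile>\<^sub>n (\<phi>[Y]\<^sub>\<mu>)"
    and "suffix k w \<Turnstile>\<^sub>n \<psi> \<Longrightarrow> suffix k w \<Turnstile>\<^sub>n (\<psi>[Y]\<^sub>\<mu>)" for k
    using Until_ltln.IH[of "suffix k w"] Until_ltln.prems(1)
    unfolding FG_suffix subformulas_nu_simps by blast+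
  then show ?case
    using Until_ltln.prems(2)
    by (simp del: semantics_ltln.simps) (blast intro: Until_mono)
next
  case (WeakUntil_ltln \<phi> \<psi>)
  have IH: "suffix k w \<Turnstile>\<^sub>n \<phi> \<Longrightarrow> suffix k w \<Turnstile>\<^sub>n (\<phi>[Y]\<^sub>\<mu>)"
    "suffix k w \<Turnstile>\<^sub>n \<psi> \<Longrightarrow> suffix k w \<Turnstile>\<^sub>n (\<psi>[Y]\<^sub>\<mu>)" for k
    using WeakUntil_ltln.IH[of "suffix k w"] WeakUntil_ltln.prems(1)
    unfolding FG_suffix subformulas_nu_simps by blast+
  show ?case
  proof (cases "w \<Turnstile>\<^sub>n (G\<^sub>n \<phi>)")
    case True
    \<comment> \<open>If \<open>\<phi>\<close> holds forever, then so does the weak until at every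
      suffix.\<close>
    then have "w \<Turnstile>\<^sub>n (F\<^sub>n (G\<^sub>n (\<phi> W\<^sub>n \<psi>)))"
      by auto
    then have "\<phi> W\<^sub>n \<psi> \<in> Y"
      using WeakUntil_ltln.prems(1) unfolding subformulas_nu_simps by blast
    then show ?thesis by simp
  next
    case False
    then have "w \<Turnstile>\<^sub>n (\<phi> U\<^sub>n \<psi>)"
      using WeakUntil_ltln.prems(2) by auto
    then have "w \<Turnstile>\<^sub>n (\<phi>[Y]\<^sub>\<mu> U\<^sub>n \<psi>[Y]\<^sub>\<mu>)"
      using IH by (blast intro: Until_mono)
    then show ?thesis
      by simp
  qed
next
  case (StrongRelease_ltln \<phi> \<psi>)
  have "suffix k w \<Turnstile>\<^sub>n \<phi> \<Longrightarrow> suffix k w \<Turnstile>\<^sub>n (\<phi>[Y]\<^sub>\<mu>)"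
    and "suffix k w \<Turnstile>\<^sub>n \<psi> \<Longrightarrow> suffix k w \<Turnstile>\<^sub>n (\<psi>[Y]\<^sub>\<mu>)" for k
    using StrongRelease_ltln.IH[of "suffix k w"] StrongRelease_ltln.prems(1)
    unfolding FG_suffix subformulas_nu_simps by blast+
  then show ?case
    using StrongRelease_ltln.prems(2)
    by (simp del: semantics_ltln.simps) (blast intro: StrongRelease_mono)
next
  case (Release_ltln \<phi> \<psi>)
  have IH: "suffix k w \<Turnstile>\<^sub>n \<phi> \<Longrightarrow> suffix k w \<Turnstile>\<^sub>n (\<phi>[Y]\<^sub>\<mu>)"
    "suffix k w \<Turnstile>\<^sub>n \<psi> \<Longrightarrow> suffix k w \<Turnstile>\<^sub>n (\<psi>[Y]\<^sub>\<mu>)" for k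
    using Release_ltln.IH[of "suffix k w"] Release_ltln.prems(1)
    unfolding FG_suffix subformulas_nu_simps by blast+
  show ?case
  proof (cases "w \<Turnstile>\<^sub>n (G\<^sub>n \<psi>)")
    case True
    then have "w \<Turnstile>\<^sub>n (F\<^sub>n (G\<^sub>n (\<phi> R\<^sub>n \<psi>)))"
      by auto
    then have "\<phi> R\<^sub>n \<psi> \<in> Y"
      using Release_ltln.prems(1) unfolding subformulas_nu_simps by blast
    then show ?thesis by simp
  next
    case False
    then have "w \<Turnstile>\<^sub>n (\<phi> M\<^sub>n \<psi>)"
      using Release_ltln.prems(2) by auto
    then have "w \<Turnstile>\<^sub>n (\<phi>[Y]\<^sub>\<mu> M\<^sub>n \<psi>[Y]\<^sub>\<mu>)"
      using IH by (blast intro: StrongRelease_mono)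
    then show ?thesis
      by simp
  qed
qed (auto simp: subformulas_nu_simps)

text \<open>A lookup in \<open>Y\<close> yields true with no further obligation, possibly at any
  suffix reached by the induction. The looked-up formulas must therefore hold from the start of
  \<open>w\<close> onwards, not merely almost always.\<close>

lemma subst_mu_sound:
  assumes "\<forall>\<chi>\<in>\<nu> \<phi> \<inter> Y. w \<Turnstile>\<^sub>n (G\<^sub>n \<chi>)" and "w \<Turnstile>\<^sub>n (\<phi>[Y]\<^sub>\<mu>)"
  shows "w \<Turnstile>\<^sub>n \<phi>"
  using assms
proof (induction \<phi> arbitrary: w)
  case (Next_ltln \<phi>)
  have "\<forall>\<chi>\<in>\<nu> \<phi> \<inter> Y. suffix 1 w \<Turnstile>\<^sub>n (G\<^sub>n \<chi>)"
    using Next_ltln.prems(1) G_suffix unfolding subformulas_nu_simps by blast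
  then show ?case
    using Next_ltln.IH Next_ltln.prems(2)
    unfolding semantics_ltln.simps(7) subst_mu.simps(7) by blast
next
  case (Finally_ltln \<phi>)
  have "suffix k w \<Turnstile>\<^sub>n (\<phi>[Y]\<^sub>\<mu>) \<Longrightarrow> suffix k w \<Turnstile>\<^sub>n \<phi>" for k
    using Finally_ltln.IH[of "suffix k w"] Finally_ltln.prems(1) G_suffix
    unfolding subformulas_nu_simps by blast
  then show ?case
    using Finally_ltln.prems(2) by auto
next
  case (Globally_ltln \<phi>)
  then have "G\<^sub>n \<phi> \<in> \<nu> (G\<^sub>n \<phi>) \<inter> Y"
    by (auto simp: subformulas_nu_simps split: if_splits)
  then show ?case
    using Globally_ltln.prems(1) semantics_of_G by blast
next
  case (Until_ltln \<phi> \<psi>)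
  have "suffix k w \<Turnstile>\<^sub>n (\<phi>[Y]\<^sub>\<mu>) \<Longrightarrow> suffix k w \<Turnstile>\<^sub>n \<phi>"
    and "suffix k w \<Turnstile>\<^sub>n (\<psi>[Y]\<^sub>\<mu>) \<Longrightarrow> suffix k w \<Turnstile>\<^sub>n \<psi>" for k
    using Until_ltln.IH[of "suffix k w"] Until_ltln.prems(1) G_suffix
    unfolding subformulas_nu_simps by blast+
  then show ?case
    using Until_ltln.prems(2)
    by (simp del: semantics_ltln.simps) (blast intro: Until_mono)
next
  case (WeakUntil_ltln \<phi> \<psi>)
  have IH: "suffix k w \<Turnstile>\<^sub>n (\<phi>[Y]\<^sub>\<mu>) \<Longrightarrow> suffix k w \<Turnstile>\<^sub>n \<phi>"
    "suffix k w \<Turnstile>\<^sub>n (\<psi>[Y]\<^sub>\<mu>) \<Longrightarrow> suffix k w \<Turnstile>\<^sub>n \<psi>" for k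
    using WeakUntil_ltln.IH[of "suffix k w"] WeakUntil_ltln.prems(1) G_suffix
    unfolding subformulas_nu_simps by blast+
  show ?case
  proof (cases "\<phi> W\<^sub>n \<psi> \<in> Y")
    case True
    then show ?thesis
      using WeakUntil_ltln.prems(1) semantics_of_G unfolding subformulas_nu_simps by blast
  next
    case False
    then show ?thesis
      using WeakUntil_ltln.prems(2) IH
      by (simp del: semantics_ltln.simps) (blast intro: Until_mono Until_imp_WeakUntil)
  qed
next
  case (StrongRelease_ltln \<phi> \<psi>)
  have "suffix k w \<Turnstile>\<^sub>n (\<phi>[Y]\<^sub>\<mu>) \<Longrightarrow> suffix k w \<Turnstile>\<^sub>n \<phi>"
    and "suffix k w \<Turnstile>\<^sub>n (\<psi>[Y]\<^sub>\<mu>) \<Longrightarrow> suffix k w \<Turnstile>\<^sub>n \<psi>" for k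
    using StrongRelease_ltln.IH[of "suffix k w"] StrongRelease_ltln.prems(1) G_suffix
    unfolding subformulas_nu_simps by blast+
  then show ?case
    using StrongRelease_ltln.prems(2)
    by (simp del: semantics_ltln.simps) (blast intro: StrongRelease_mono)
next
  case (Release_ltln \<phi> \<psi>)
  have IH: "suffix k w \<Turnstile>\<^sub>n (\<phi>[Y]\<^sub>\<mu>) \<Longrightarrow> suffix k w \<Turnstile>\<^sub>n \<phi>"
    "suffix k w \<Turnstile>\<^sub>n (\<psi>[Y]\<^sub>\<mu>) \<Longrightarrow> suffix k w \<Turnstile>\<^sub>n \<psi>" for k
    using Release_ltln.IH[of "suffix k w"] Release_ltln.prems(1) G_suffix
    unfolding subformulas_nu_simps by blast+
  show ?case
  proof (cases "\<phi> R\<^sub>n \<psi> \<in> Y")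
    case True
    then show ?thesis
      using Release_ltln.prems(1) semantics_of_G unfolding subformulas_nu_simps by blast
  next
    case False
    then show ?thesis
      using Release_ltln.prems(2) IH
      by (simp del: semantics_ltln.simps) (blast intro: StrongRelease_mono StrongRelease_imp_Release)
  qed
qed (auto simp: subformulas_nu_simps)

section \<open>Stabilisation, joint soundness of \<open>X\<close> and \<open>Y\<close>, and both
  directions of the equivalence\<close>

section \<open>The Master Theorem\<close>

text \<open>A formula that does not recur has no occurrence from some position on. Finiteness of
  \<open>S\<close> gives one threshold for all its members.\<close>

lemma eventually_F_imp_GF:
  assumes "finite S"
  shows "\<forall>\<^sub>F k in sequentially. \<forall>\<chi>\<in>S. suffix k w \<Turnstile>\<^sub>n (F\<^sub>n \<chi>) \<longrightarrow> w \<Turnstile>\<^sub>n (G\<^sub>n (F\<^sub>n \<chi>))"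
proof (rule eventually_ball_finite[OF assms], rule ballI)
  fix \<chi>
  show "\<forall>\<^sub>F k in sequentially. suffix k w \<Turnstile>\<^sub>n (F\<^sub>n \<chi>) \<longrightarrow> w \<Turnstile>\<^sub>n (G\<^sub>n (F\<^sub>n \<chi>))"
  proof (cases "w \<Turnstile>\<^sub>n (G\<^sub>n (F\<^sub>n \<chi>))")
    case False
    then obtain n where "\<not> suffix n w \<Turnstile>\<^sub>n (F\<^sub>n \<chi>)"
      by auto
    then have "\<not> suffix k w \<Turnstile>\<^sub>n (F\<^sub>n \<chi>)" if "n \<le> k" for k
      using F_suffix[of "k - n" "suffix n w" \<chi>] that by auto
    then show ?thesis
      unfolding eventually_sequentially by blast
  qed simp
qed

text \<open>Once \<open>G \<chi>\<close> holds it holds at every later suffix. This turns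
  almost-always truth into the hypothesis of \<open>subst_mu_sound\<close> on late suffixes.\<close>

lemma eventually_G_of_FG:
  assumes "w \<Turnstile>\<^sub>n (F\<^sub>n (G\<^sub>n \<chi>))"
  shows "\<forall>\<^sub>F k in sequentially. suffix k w \<Turnstile>\<^sub>n (G\<^sub>n \<chi>)"
proof -
  have "w \<Turnstile>\<^sub>n (F\<^sub>n (G\<^sub>n (G\<^sub>n \<chi>)))"
    using assms by (auto simp: add.assoc)
  then show ?thesis
    unfolding semantics_FG_iff .
qed

text \<open>Both implications are proved together because each half uses the other for smaller
  formulas. The \<open>X\<close> half works only on late suffixes, the \<open>Y\<close> half on
  every suffix.\<close>

lemma substitution_sets_sound:
  assumes X: "X \<subseteq> \<mu> \<phi>" and Y: "Y \<subseteq> \<nu> \<phi>"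
    and GF: "\<forall>\<psi>\<in>X. w \<Turnstile>\<^sub>n (G\<^sub>n (F\<^sub>n (\<psi>[Y]\<^sub>\<mu>)))"
    and FG: "\<forall>\<psi>\<in>Y. w \<Turnstile>\<^sub>n (F\<^sub>n (G\<^sub>n (\<psi>[X]\<^sub>\<nu>)))"
  shows "(\<psi> \<in> X \<longrightarrow> w \<Turnstile>\<^sub>n (G\<^sub>n (F\<^sub>n \<psi>))) \<and> (\<psi> \<in> Y \<longrightarrow> w \<Turnstile>\<^sub>n (F\<^sub>n (G\<^sub>n \<psi>)))"
proof (induction \<psi> rule: measure_induct_rule[of size])
  case (less \<psi>)
  have "w \<Turnstile>\<^sub>n (G\<^sub>n (F\<^sub>n \<psi>))" if "\<psi> \<in> X"
  proof -
    have "\<forall>\<chi>\<in>\<nu> \<psi> \<inter> Y. \<forall>\<^sub>F k in sequentially. suffix k w \<Turnstile>\<^sub>n (G\<^sub>n \<chi>)"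
    proof
      fix \<chi>
      assume \<chi>: "\<chi> \<in> \<nu> \<psi> \<inter> Y"
      then have "\<chi> \<in> subformulas \<psi>"
        unfolding subformulas_nu_def by blast
      moreover have "\<chi> \<noteq> \<psi>"
        using \<chi> that X subformulas_mu_nu_disjoint[of \<phi> \<psi>] by blast
      ultimately have "size \<chi> < size \<psi>"
        using subformulas_size by blast
      then show "\<forall>\<^sub>F k in sequentially. suffix k w \<Turnstile>\<^sub>n (G\<^sub>n \<chi>)"
        using \<chi> less.IH[of \<chi>] eventually_G_of_FG[of w \<chi>] by blast
    qed
    \<comment> \<open>Finitely many thresholds have a common bound, beyond which all relevant
      members of \<open>Y\<close> hold forever.\<close>
    then have "\<forall>\<^sub>F k in sequentially. \<forall>\<chi>\<in>\<nu> \<psi> \<inter> Y. suffix k w \<Turnstile>\<^sub>n (G\<^sub>n \<chi>)"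
      by (rule eventually_ball_finite[OF finite_subset[OF Int_lower1 finite_subformulas_nu]])
    then have "\<forall>\<^sub>F k in sequentially. suffix k w \<Turnstile>\<^sub>n (\<psi>[Y]\<^sub>\<mu>) \<longrightarrow> suffix k w \<Turnstile>\<^sub>n \<psi>"
      by (rule eventually_mono) (blast intro: subst_mu_sound)
    moreover have "\<exists>\<^sub>F k in sequentially. suffix k w \<Turnstile>\<^sub>n (\<psi>[Y]\<^sub>\<mu>)"
      using GF that unfolding semantics_GF_iff by blast
    \<comment> \<open>An implication valid almost always transfers truth at infinitely many
      positions.\<close>
    ultimately have "\<exists>\<^sub>F k in sequentially. suffix k w \<Turnstile>\<^sub>n \<psi>"
      by (rule frequently_mp)
    then show ?thesis
      unfolding semantics_GF_iff .
  qed
  moreover have "w \<Turnstile>\<^sub>n (F\<^sub>n (G\<^sub>n \<psi>))" if "\<psi> \<in> Y"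
  proof -
    have "w \<Turnstile>\<^sub>n (G\<^sub>n (F\<^sub>n \<chi>))" if "\<chi> \<in> \<mu> \<psi> \<inter> X" for \<chi>
    proof -
      have "\<chi> \<in> subformulas \<psi>"
        using that unfolding subformulas_mu_def by blast
      moreover have "\<chi> \<noteq> \<psi>"
        using that \<open>\<psi> \<in> Y\<close> Y subformulas_mu_nu_disjoint[of \<psi> \<phi>] by blast
      ultimately have "size \<chi> < size \<psi>"
        using subformulas_size by blast
      then show ?thesis
        using that less.IH[of \<chi>] by blast
    qed
    then have "suffix k w \<Turnstile>\<^sub>n (\<psi>[X]\<^sub>\<nu>) \<Longrightarrow> suffix k w \<Turnstile>\<^sub>n \<psi>" for k
      using subst_nu_sound[of \<psi> X "suffix k w"] unfolding GF_suffix by blast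
    moreover have "\<forall>\<^sub>F k in sequentially. suffix k w \<Turnstile>\<^sub>n (\<psi>[X]\<^sub>\<nu>)"
      using FG that unfolding semantics_FG_iff by blast
    ultimately show ?thesis
      unfolding semantics_FG_iff by (blast intro: eventually_mono)
  qed
  ultimately show ?case by blast
qed

theorem theorem5p12:
  fixes Ap :: "'a set" and \<phi> :: "'a ltln" and w :: "'a set word"
  assumes "finite Ap"
    and "atoms \<phi> \<subseteq> Ap"
    and "range w \<subseteq> Pow Ap"
  shows "w \<Turnstile>\<^sub>n \<phi> \<longleftrightarrow>
    (\<exists>X Y. X \<subseteq> \<mu> \<phi> \<and> Y \<subseteq> \<nu> \<phi>
      \<and> (\<exists>i. suffix i w \<Turnstile>\<^sub>n ((af \<phi> (w [0 \<rightarrow> i]))[X]\<^sub>\<nu>))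
      \<and> (\<forall>\<psi>\<in>X. w \<Turnstile>\<^sub>n (G\<^sub>n (F\<^sub>n (\<psi>[Y]\<^sub>\<mu>))))
      \<and> (\<forall>\<psi>\<in>Y. w \<Turnstile>\<^sub>n (F\<^sub>n (G\<^sub>n (\<psi>[X]\<^sub>\<nu>)))))"
    (is "_ \<longleftrightarrow> ?R")
proof
  assume w: "w \<Turnstile>\<^sub>n \<phi>"
  define X where "X = {\<psi> \<in> \<mu> \<phi>. w \<Turnstile>\<^sub>n (G\<^sub>n (F\<^sub>n \<psi>))}"
  define Y where "Y = {\<psi> \<in> \<nu> \<phi>. w \<Turnstile>\<^sub>n (F\<^sub>n (G\<^sub>n \<psi>))}"
  \<comment> \<open>Beyond this threshold, \<open>X\<close> contains every formula of
    \<open>\<mu> \<phi>\<close> that still occurs. It supplies the index \<open>i\<close> and is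
    reused for condition (3).\<close>
  have stable: "\<forall>\<^sub>F k in sequentially. \<forall>\<chi>\<in>\<mu> \<phi>. suffix k w \<Turnstile>\<^sub>n (F\<^sub>n \<chi>) \<longrightarrow> \<chi> \<in> X"
    using eventually_F_imp_GF[OF finite_subformulas_mu, of \<phi> w]
    by (rule eventually_mono) (auto simp: X_def)
  then obtain i where i: "\<forall>\<chi>\<in>\<mu> \<phi>. suffix i w \<Turnstile>\<^sub>n (F\<^sub>n \<chi>) \<longrightarrow> \<chi> \<in> X"
    unfolding eventually_sequentially by blast
  have "suffix i w \<Turnstile>\<^sub>n ((af \<phi> (w [0 \<rightarrow> i]))[X]\<^sub>\<nu>)"
    using i w semantics_af subformulas_mu_af by (intro subst_nu_complete) blast+
  moreover have "w \<Turnstile>\<^sub>n (G\<^sub>n (F\<^sub>n (\<psi>[Y]\<^sub>\<mu>)))" if "\<psi> \<in> X" for \<psi>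
  proof -
    have "\<nu> \<psi> \<subseteq> \<nu> \<phi>"
      using that subformulas_nu_subset unfolding X_def subformulas_mu_def by blast
    \<comment> \<open>\<open>Y\<close> is defined by limit behaviour, so
      \<open>subst_mu_complete\<close> applies at every suffix.\<close>
    then have "suffix k w \<Turnstile>\<^sub>n \<psi> \<Longrightarrow> suffix k w \<Turnstile>\<^sub>n (\<psi>[Y]\<^sub>\<mu>)" for k
      using subst_mu_complete[of \<psi> "suffix k w" Y] unfolding FG_suffix Y_def by blast
    moreover have "\<exists>\<^sub>F k in sequentially. suffix k w \<Turnstile>\<^sub>n \<psi>"
      using that unfolding X_def semantics_GF_iff by blast
    ultimately show ?thesis
      unfolding semantics_GF_iff by (auto elim: frequently_elim1)
  qed
  moreover have "w \<Turnstile>\<^sub>n (F\<^sub>n (G\<^sub>n (\<psi>[X]\<^sub>\<nu>)))" if "\<psi> \<in> Y" for \<psi>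
  proof -
    have "\<mu> \<psi> \<subseteq> \<mu> \<phi>"
      using that subformulas_mu_subset unfolding Y_def subformulas_nu_def by blast
    \<comment> \<open>Preservation by \<open>X\<close> needs the stability condition at
      \<open>k\<close>, so it is available only almost always; that suffices for FG.\<close>
    then have *: "suffix k w \<Turnstile>\<^sub>n (\<psi>[X]\<^sub>\<nu>)"
      if "suffix k w \<Turnstile>\<^sub>n \<psi>" "\<forall>\<chi>\<in>\<mu> \<phi>. suffix k w \<Turnstile>\<^sub>n (F\<^sub>n \<chi>) \<longrightarrow> \<chi> \<in> X" for k
      using that by (blast intro: subst_nu_complete)
    have "\<forall>\<^sub>F k in sequentially. suffix k w \<Turnstile>\<^sub>n \<psi>"
      using that unfolding Y_def semantics_FG_iff by blast
    then show ?thesis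
      unfolding semantics_FG_iff using stable by (rule eventually_elim2) (rule *)
  qed
  moreover have "X \<subseteq> \<mu> \<phi>" "Y \<subseteq> \<nu> \<phi>"
    unfolding X_def Y_def by auto
  ultimately show ?R by blast
next
  assume ?R
  then obtain X Y i where X: "X \<subseteq> \<mu> \<phi>" "Y \<subseteq> \<nu> \<phi>"
    and i: "suffix i w \<Turnstile>\<^sub>n ((af \<phi> (w [0 \<rightarrow> i]))[X]\<^sub>\<nu>)"
    and "\<forall>\<psi>\<in>X. w \<Turnstile>\<^sub>n (G\<^sub>n (F\<^sub>n (\<psi>[Y]\<^sub>\<mu>)))" "\<forall>\<psi>\<in>Y. w \<Turnstile>\<^sub>n (F\<^sub>n (G\<^sub>n (\<psi>[X]\<^sub>\<nu>)))"
    by blast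
  then have "\<forall>\<chi>\<in>X. suffix i w \<Turnstile>\<^sub>n (G\<^sub>n (F\<^sub>n \<chi>))"
    using substitution_sets_sound GF_suffix by blast
  \<comment> \<open>The soundness hypothesis only concerns members of \<open>X\<close>, so it covers
    the unfolded formula as well as \<open>\<phi>\<close>.\<close>
  then have "suffix i w \<Turnstile>\<^sub>n af \<phi> (w [0 \<rightarrow> i])"
    using i subst_nu_sound by blast
  then show "w \<Turnstile>\<^sub>n \<phi>"
    using semantics_af by blast
qed

end
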